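(* Let $J=J_3(\mathbb O_{\mathbb C})$ be the complex Albert algebra with Jordan product $\circ$, $L_A(X)=A\circ X$, diagonal idempotents $p_1,p_2,p_3$ and Peirce fibres $F_i(\mathbb O_{\mathbb C})$. For $z\in\mathbb O_{\mathbb C}$ set $$\mathcal D_{12}(z)=2\,[L_{p_1-p_2},L_{F_3(z)}].$$ Then $\mathcal D_{12}(z)$ is a derivation of $J$ (an element of $\mathfrak f_4(\mathbb C)$), and for all $x,y\in\mathbb O_{\mathbb C}$ $$\mathcal D_{12}(z)F_1(x)=F_2(\bar x\,\bar z),\qquad \mathcal D_{12}(z)F_2(y)=-F_1(\bar z\,\bar y).$$ Moreover, for $\chi\in\mathbb R$ let $g_\chi=\cos\chi\,e_3-\sin\chi\,e_1$ and $$u_1=e_4+ie_5,\quad u_2=e_6+ie_2,\quad \bar d_1=e_5+ie_4,\quad \bar d_2=e_2+ie_6 .$$ Then $$\mathcal D_{12}(-g_\chi)F_1(u_1)=F_2(e^{-i\chi}u_2),\qquad \mathcal D_{12}(-g_\chi)F_1(\bar d_1)=F_2(e^{+i\chi}\bar d_2),$$ and for all $\theta\in\mathbb R$ $$e^{\theta\mathcal D_{12}(-g_\chi)}F_1(u_1)=\cos\theta\,F_1(u_1)+\sin\theta\,F_2(e^{-i\chi}u_2),$$ $$e^{\theta\mathcal D_{12}(-g_\chi)}F_1(\bar d_1)=\cos\theta\,F_1(\bar d_1)+\sin\theta\,F_2(e^{+i\chi}\bar d_2).$$ Consequently the up and anti-down transport amplitudes $A_u=e^{-i\chi}$, $A_d=e^{i\chi}$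 are complex conjugate and their relative phase is $\varphi_{12}=\arg A_u-\arg A_d=-2\chi$ (mod $2\pi$).
   Context: $\mathbb O_{\mathbb C}=\mathbb C\otimes\mathbb O$ is the complexified octonion algebra with unit $1$ and imaginary units $e_1,\dots,e_7$, where $e_k^2=-1$, and $e_ke_{k+1}=e_{k+3}$ with indices mod $7$ in $\{1,\dots,7\}$, each such triple $(e_k,e_{k+1},e_{k+3})$ multiplying cyclically like quaternion units and distinct imaginary units anticommuting. The scalar $i$ is the central complex unit. The bar is the $\mathbb C$-linear octonionic conjugation ($\bar e_k=-e_k$, $\bar i=i$). Elements of $J_3(\mathbb O_{\mathbb C})$ are matrices $\begin{pmatrix} \xi_1 & x_3 & \bar x_2 \\ \bar x_3 & \xi_2 & x_1 \\ x_2 & \bar x_1 & \xi_3 \end{pmatrix}$ with $\xi_i\in\mathbb C$, $x_i\in\mathbb O_{\mathbb C}$, and $A\circ B=\frac12(AB+BA)$. $p_i=E_{ii}$, and $F_i(x)$ is the matrix with $x_i=x$ and all other coordinates zero (so $F_1(x)$ has $x$ at position $(2,3)$, $F_2(x)$ has $x$ at position $(3,1)$, $F_3(x)$ has $x$ at position $(1,2)$, with $\bar x$ at the transposed position). *)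

theory Defs
  imports "HOL-Analysis.Analysis" "HOL-Library.Real_Mod"
begin

section \<open>Complexified octonions\<close>

text \<open>
  An element of the complexified octonions is a pair of its coefficient at the unit and its
  coefficient vector at the imaginary units. The latter is indexed by the type \<open>7\<close>, whose
  arithmetic is arithmetic modulo 7; thus \<open>oct_e 7\<close> is \<open>oct_e 0\<close>, and the rule
  \<open>e_k e_{k+1} = e_{k+3}\<close> needs no further index convention.
\<close>

type_synonym oct = "complex \<times> (complex ^ 7)"

definition oct_of :: "complex \<Rightarrow> oct" where
  "oct_of c = (c, 0)"

definition oct_e :: "7 \<Rightarrow> oct" where
  "oct_e k = (0, axis k 1)"

definition oct_scale :: "complex \<Rightarrow> oct \<Rightarrow> oct"  (infixr \<open>*\<^sub>C\<close> 75) where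
  "c *\<^sub>C x = (c * fst x, c *s snd x)"

definition oct_cnj :: "oct \<Rightarrow> oct" where
  "oct_cnj x = (fst x, - snd x)"

text \<open>
  The three lines of the component at \<open>m\<close> of the cross product come from the three ways in
  which \<open>m\<close> can occur in a triple \<open>(k, k+1, k+3)\<close>: as third, first and second member.
\<close>

definition oct_cross :: "complex ^ 7 \<Rightarrow> complex ^ 7 \<Rightarrow> complex ^ 7" where
  "oct_cross v w = (\<chi> m.
      (v $ (m - 3) * w $ (m - 2) - v $ (m - 2) * w $ (m - 3))
    + (v $ (m + 1) * w $ (m + 3) - v $ (m + 3) * w $ (m + 1))
    + (v $ (m + 2) * w $ (m - 1) - v $ (m - 1) * w $ (m + 2)))"

definition oct_mult :: "oct \<Rightarrow> oct \<Rightarrow> oct"  (infixl \<open>\<odot>\<close> 70) where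
  "x \<odot> y = (fst x * fst y - (\<Sum>k\<in>UNIV. snd x $ k * snd y $ k),
            fst x *s snd y + fst y *s snd x + oct_cross (snd x) (snd y))"

text \<open>The multiplication table characterising the product.\<close>

lemma exhaust_7:
  fixes k :: 7
  shows "k = 0 \<or> k = 1 \<or> k = 2 \<or> k = 3 \<or> k = 4 \<or> k = 5 \<or> k = 6"
proof (cases k)
  case (of_int z)
  then have "z = 0 \<or> z = 1 \<or> z = 2 \<or> z = 3 \<or> z = 4 \<or> z = 5 \<or> z = 6"
    by auto
  with of_int(1) show ?thesis by auto
qed

lemma all_7: "(\<forall>k::7. P k) \<longleftrightarrow> P 0 \<and> P 1 \<and> P 2 \<and> P 3 \<and> P 4 \<and> P 5 \<and> P 6"
  using exhaust_7 by metis

lemma sum_axis_axis: "(\<Sum>i\<in>UNIV. axis j (1::complex) $ i * axis k 1 $ i) = (if j = k then 1 else (0::complex))"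
  for j k :: 7
proof -
  have "(\<Sum>i\<in>UNIV. axis j (1::complex) $ i * axis k 1 $ i) = (\<Sum>i\<in>UNIV. if i = j then axis k 1 $ j else 0)"
    by (rule sum.cong) (auto simp: axis_def)
  then show ?thesis by (auto simp: axis_def)
qed

lemma oct_e_mult: "oct_e j \<odot> oct_e k = (if j = k then -1 else 0, oct_cross (axis j 1) (axis k 1))"
  by (simp add: oct_e_def oct_mult_def sum_axis_axis vec_eq_iff)

lemma oct_cross_anticomm: "oct_cross v w = - oct_cross w v"
  by (simp add: oct_cross_def vec_eq_iff algebra_simps)

lemma oct_e_square: "oct_e k \<odot> oct_e k = - oct_of 1"
  by (simp add: oct_e_mult oct_of_def oct_cross_def vec_eq_iff)

lemma oct_e_anticomm: "j \<noteq> k \<Longrightarrow> oct_e j \<odot> oct_e k = - (oct_e k \<odot> oct_e j)"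
  by (simp add: oct_e_mult oct_cross_anticomm[of "axis j 1"])

lemma oct_e_triple:
  "oct_e k \<odot> oct_e (k + 1) = oct_e (k + 3)"
  "oct_e (k + 1) \<odot> oct_e (k + 3) = oct_e k"
  "oct_e (k + 3) \<odot> oct_e k = oct_e (k + 1)"
proof -
  have "\<forall>k. oct_e k \<odot> oct_e (k + 1) = oct_e (k + 3) \<and>
    oct_e (k + 1) \<odot> oct_e (k + 3) = oct_e k \<and>
    oct_e (k + 3) \<odot> oct_e k = oct_e (k + 1)"
    unfolding oct_e_mult unfolding oct_e_def oct_cross_def vec_eq_iff all_7 prod.inject
    by (simp add: axis_def)
  then show "oct_e k \<odot> oct_e (k + 1) = oct_e (k + 3)"
    "oct_e (k + 1) \<odot> oct_e (k + 3) = oct_e k"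
    "oct_e (k + 3) \<odot> oct_e k = oct_e (k + 1)"
    by blast+
qed

lemma oct_of_mult: "oct_of c \<odot> x = c *\<^sub>C x" "x \<odot> oct_of c = c *\<^sub>C x"
  by (simp_all add: oct_of_def oct_mult_def oct_scale_def oct_cross_def vec_eq_iff mult.commute)


section \<open>The complex Albert algebra\<close>

type_synonym omat = "oct ^ 3 ^ 3"

definition herm :: "complex \<Rightarrow> complex \<Rightarrow> complex \<Rightarrow> oct \<Rightarrow> oct \<Rightarrow> oct \<Rightarrow> omat" where
  "herm \<xi>\<^sub>1 \<xi>\<^sub>2 \<xi>\<^sub>3 x\<^sub>1 x\<^sub>2 x\<^sub>3 = vector
    [vector [oct_of \<xi>\<^sub>1,  x\<^sub>3,         oct_cnj x\<^sub>2],
     vector [oct_cnj x\<^sub>3, oct_of \<xi>\<^sub>2,  x\<^sub>1],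
     vector [x\<^sub>2,         oct_cnj x\<^sub>1, oct_of \<xi>\<^sub>3]]"

definition J3 :: "omat set" where
  "J3 = {herm \<xi>\<^sub>1 \<xi>\<^sub>2 \<xi>\<^sub>3 x\<^sub>1 x\<^sub>2 x\<^sub>3 | \<xi>\<^sub>1 \<xi>\<^sub>2 \<xi>\<^sub>3 x\<^sub>1 x\<^sub>2 x\<^sub>3. True}"

definition omat_scale :: "complex \<Rightarrow> omat \<Rightarrow> omat" where
  "omat_scale c A = (\<chi> i j. c *\<^sub>C (A $ i $ j))"

definition omat_mult :: "omat \<Rightarrow> omat \<Rightarrow> omat" where
  "omat_mult A B = (\<chi> i j. \<Sum>k\<in>UNIV. (A $ i $ k) \<odot> (B $ k $ j))"

definition jordan :: "omat \<Rightarrow> omat \<Rightarrow> omat" where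
  "jordan A B = (1/2) *\<^sub>R (omat_mult A B + omat_mult B A)"

definition Lmult :: "omat \<Rightarrow> omat \<Rightarrow> omat" where
  "Lmult A = (\<lambda>X. jordan A X)"

definition pidem :: "3 \<Rightarrow> omat" where
  "pidem i = (\<chi> j k. if j = i \<and> k = i then oct_of 1 else 0)"

definition F1 :: "oct \<Rightarrow> omat" where "F1 x = herm 0 0 0 x 0 0"
definition F2 :: "oct \<Rightarrow> omat" where "F2 x = herm 0 0 0 0 x 0"
definition F3 :: "oct \<Rightarrow> omat" where "F3 x = herm 0 0 0 0 0 x"

definition op_comm :: "(omat \<Rightarrow> omat) \<Rightarrow> (omat \<Rightarrow> omat) \<Rightarrow> (omat \<Rightarrow> omat)" where
  "op_comm S T = (\<lambda>X. S (T X) - T (S X))"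

text \<open>
  Operators on \<open>J3\<close> are represented by functions on all matrices, of which only the
  restriction to \<open>J3\<close> matters.
\<close>

definition derivation_J3 :: "(omat \<Rightarrow> omat) \<Rightarrow> bool" where
  "derivation_J3 D \<longleftrightarrow>
     (\<forall>A\<in>J3. D A \<in> J3) \<and>
     (\<forall>A\<in>J3. \<forall>B\<in>J3. D (A + B) = D A + D B) \<and>
     (\<forall>c. \<forall>A\<in>J3. D (omat_scale c A) = omat_scale c (D A)) \<and>
     (\<forall>A\<in>J3. \<forall>B\<in>J3. D (jordan A B) = jordan (D A) B + jordan A (D B))"

definition f4C :: "(omat \<Rightarrow> omat) set" where
  "f4C = {D. derivation_J3 D}"

definition D12 :: "oct \<Rightarrow> omat \<Rightarrow> omat" where
  "D12 z = (\<lambda>X. 2 *\<^sub>R op_comm (Lmult (pidem 1 - pidem 2)) (Lmult (F3 z)) X)"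

text \<open>
  The exponential of a linear operator, as the pointwise sum of its power series; in finite
  dimension this is the sum in operator norm, and the series always converges.
\<close>

definition op_exp :: "(omat \<Rightarrow> omat) \<Rightarrow> omat \<Rightarrow> omat" where
  "op_exp T = (\<lambda>X. \<Sum>n. (1 / fact n) *\<^sub>R (T ^^ n) X)"

lemma summable_op_exp:
  fixes T :: "omat \<Rightarrow> omat"
  assumes "linear T"
  shows "summable (\<lambda>n. (1 / fact n) *\<^sub>R (T ^^ n) X)"
proof -
  obtain K where K: "K > 0" "\<And>x. norm (T x) \<le> K * norm x"
    using linear_bounded_pos[OF assms] by blast
  have le: "norm ((T ^^ n) X) \<le> K ^ n * norm X" for n
  proof (induction n)
    case (Suc n)
    have "norm ((T ^^ Suc n) X) \<le> K * norm ((T ^^ n) X)" using K(2) by simp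
    also have "\<dots> \<le> K * (K ^ n * norm X)" using Suc K(1) by simp
    finally show ?case by (simp add: mult.assoc)
  qed simp
  have s: "summable (\<lambda>n. inverse (fact n) * K ^ n * norm X)"
    by (intro summable_mult2 summable_exp)
  show ?thesis
  proof (rule summable_comparison_test'[OF s])
    fix n :: nat
    show "norm ((1 / fact n) *\<^sub>R (T ^^ n) X) \<le> inverse (fact n) * K ^ n * norm X"
      using le[of n] by (simp add: divide_inverse mult.assoc mult_left_mono)
  qed
qed


section \<open>The transport data\<close>

definition gdir :: "real \<Rightarrow> oct" where
  "gdir chi = cos chi *\<^sub>R oct_e 3 - sin chi *\<^sub>R oct_e 1"

definition u1 :: oct where "u1 = oct_e 4 + \<i> *\<^sub>C oct_e 5"
definition u2 :: oct where "u2 = oct_e 6 + \<i> *\<^sub>C oct_e 2"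

text \<open>
  The bar in \<open>dbar1\<close> and \<open>dbar2\<close> is part of the name (anti-down states); it is not an
  application of \<open>oct_cnj\<close>.
\<close>

definition dbar1 :: oct where "dbar1 = oct_e 5 + \<i> *\<^sub>C oct_e 4"
definition dbar2 :: oct where "dbar2 = oct_e 2 + \<i> *\<^sub>C oct_e 6"

text \<open>
  The amplitude with which the derivation \<open>D12 z\<close> transports \<open>F1 x\<close> to the direction of
  \<open>F2 y\<close>: the scalar \<open>A\<close> with \<open>D12 z (F1 x) = F2 (A y)\<close>.
\<close>

definition transport_amplitude :: "oct \<Rightarrow> oct \<Rightarrow> oct \<Rightarrow> complex" where
  "transport_amplitude z x y = (THE A. D12 z (F1 x) = F2 (A *\<^sub>C y))"

definition A_u :: "real \<Rightarrow> complex" where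
  "A_u chi = transport_amplitude (- gdir chi) u1 u2"

definition A_d :: "real \<Rightarrow> complex" where
  "A_d chi = transport_amplitude (- gdir chi) dbar1 dbar2"

definition phase12 :: "real \<Rightarrow> real" where
  "phase12 chi = Arg (A_u chi) - Arg (A_d chi)"

end

(*
  In the coordinates (xi_1, xi_2, xi_3, x_1, x_2, x_3) and with the bilinear norm form (x, y),
  D12 z sends an element to
    (2 (z, x_3), - 2 (z, x_3), 0, - bar z bar x_2, bar x_1 bar z, (xi_2 - xi_1) z).
  The Leibniz rule then reduces, coordinate by coordinate, to the linearised composition identities
  bar x (y w) + bar y (x w) = 2 (x, y) w and (w x) bar y + (w y) bar x = 2 (x, y) w, together with
  the cyclicity of the trilinear form (xy, bar w). If (z, z) = 1, the first identity also shows that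
  D12 z acts on the span of F1 x and F2 (bar x bar z) as an infinitesimal rotation, which determines
  its exponential.
*)

theory Submission
  imports Defs
begin

section \<open>Identities of the complexified octonions\<close>

lemma sum_7: "sum f (UNIV::7 set) = f 0 + f 1 + f 2 + f 3 + f 4 + f 5 + f 6"
proof -
  have *: "UNIV = {0, 1, 2, 3, 4, 5, 6 :: 7}" using exhaust_7 by blast
  show ?thesis unfolding * by (simp add: add.assoc)
qed

lemma numeral_7_reduce:
  "(- 1 :: 7) = 6" "(- 2 :: 7) = 5" "(- 3 :: 7) = 4"
  "(7 :: 7) = 0" "(8 :: 7) = 1" "(9 :: 7) = 2"
  by simp_all

lemma oct_cross_nth:
  "oct_cross v w $ 0 = v $ 4 * w $ 5 - v $ 5 * w $ 4
    + (v $ 1 * w $ 3 - v $ 3 * w $ 1) + (v $ 2 * w $ 6 - v $ 6 * w $ 2)"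
  "oct_cross v w $ 1 = v $ 5 * w $ 6 - v $ 6 * w $ 5
    + (v $ 2 * w $ 4 - v $ 4 * w $ 2) + (v $ 3 * w $ 0 - v $ 0 * w $ 3)"
  "oct_cross v w $ 2 = v $ 6 * w $ 0 - v $ 0 * w $ 6
    + (v $ 3 * w $ 5 - v $ 5 * w $ 3) + (v $ 4 * w $ 1 - v $ 1 * w $ 4)"
  "oct_cross v w $ 3 = v $ 0 * w $ 1 - v $ 1 * w $ 0
    + (v $ 4 * w $ 6 - v $ 6 * w $ 4) + (v $ 5 * w $ 2 - v $ 2 * w $ 5)"
  "oct_cross v w $ 4 = v $ 1 * w $ 2 - v $ 2 * w $ 1
    + (v $ 5 * w $ 0 - v $ 0 * w $ 5) + (v $ 6 * w $ 3 - v $ 3 * w $ 6)"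
  "oct_cross v w $ 5 = v $ 2 * w $ 3 - v $ 3 * w $ 2
    + (v $ 6 * w $ 1 - v $ 1 * w $ 6) + (v $ 0 * w $ 4 - v $ 4 * w $ 0)"
  "oct_cross v w $ 6 = v $ 3 * w $ 4 - v $ 4 * w $ 3
    + (v $ 0 * w $ 2 - v $ 2 * w $ 0) + (v $ 1 * w $ 5 - v $ 5 * w $ 1)"
  by (simp_all add: oct_cross_def numeral_7_reduce)

text \<open>The polar form of the octonion norm: the coefficient at the unit of
  \<open>x \<odot> oct_cnj y\<close>. It is complex bilinear, not Hermitian, so vectors such as
  \<open>u1\<close> are isotropic.\<close>

definition oct_dot :: "oct \<Rightarrow> oct \<Rightarrow> complex" where
  "oct_dot x y = fst x * fst y + (\<Sum>k\<in>UNIV. snd x $ k * snd y $ k)"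

lemma oct_cnj_mult: "oct_cnj (x \<odot> y) = oct_cnj y \<odot> oct_cnj x"
  by (simp add: oct_cnj_def oct_mult_def oct_cross_def vec_eq_iff algebra_simps)

text \<open>Polarisation of bar x (x w) = (x, x) w. It stands in for associativity whenever two
  factors have to change places.\<close>

lemma oct_mult_cnj_left:
  "oct_cnj x \<odot> (y \<odot> w) + oct_cnj y \<odot> (x \<odot> w) = (2 * oct_dot x y) *\<^sub>C w"
  unfolding prod_eq_iff vec_eq_iff all_7
  by (simp add: oct_cnj_def oct_mult_def oct_dot_def oct_scale_def sum_7 oct_cross_nth algebra_simps)

text \<open>Both sides are the coefficient at the unit of the product of bar x, bar z, bar y, which
  depends neither on bracketing nor on cyclic rotation.\<close>

lemma oct_dot_cyclic: "oct_dot (oct_cnj x \<odot> oct_cnj z) y = oct_dot z (oct_cnj y \<odot> oct_cnj x)"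
  by (simp add: oct_cnj_def oct_mult_def oct_dot_def sum_7 oct_cross_nth algebra_simps)

lemma oct_scale_simps:
  "a *\<^sub>C (x + y) = a *\<^sub>C x + a *\<^sub>C y"
  "(a + b) *\<^sub>C x = a *\<^sub>C x + b *\<^sub>C x"
  "a *\<^sub>C (x - y) = a *\<^sub>C x - a *\<^sub>C y"
  "(a - b) *\<^sub>C x = a *\<^sub>C x - b *\<^sub>C x"
  "a *\<^sub>C (- x) = - (a *\<^sub>C x)"
  "(- a) *\<^sub>C x = - (a *\<^sub>C x)"
  "a *\<^sub>C b *\<^sub>C x = (a * b) *\<^sub>C x"
  "1 *\<^sub>C x = x" "0 *\<^sub>C x = 0" "a *\<^sub>C 0 = 0"
  by (simp_all add: oct_scale_def prod_eq_iff vec_eq_iff algebra_simps)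

lemma oct_scaleR: "r *\<^sub>R x = of_real r *\<^sub>C x" for x :: oct
  by (simp add: oct_scale_def prod_eq_iff vec_eq_iff scaleR_conv_of_real[where 'a=complex])

lemma oct_cnj_simps:
  "oct_cnj (x + y) = oct_cnj x + oct_cnj y"
  "oct_cnj (x - y) = oct_cnj x - oct_cnj y"
  "oct_cnj (- x) = - oct_cnj x"
  "oct_cnj (a *\<^sub>C x) = a *\<^sub>C oct_cnj x"
  "oct_cnj (oct_cnj x) = x" "oct_cnj 0 = 0"
  by (simp_all add: oct_cnj_def oct_scale_def prod_eq_iff vec_eq_iff)

lemma oct_mult_simps:
  "(x + y) \<odot> w = x \<odot> w + y \<odot> w" "w \<odot> (x + y) = w \<odot> x + w \<odot> y"
  "(x - y) \<odot> w = x \<odot> w - y \<odot> w" "w \<odot> (x - y) = w \<odot> x - w \<odot> y"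
  "(- x) \<odot> w = - (x \<odot> w)" "w \<odot> (- x) = - (w \<odot> x)"
  "(a *\<^sub>C x) \<odot> w = a *\<^sub>C (x \<odot> w)" "w \<odot> (a *\<^sub>C x) = a *\<^sub>C (w \<odot> x)"
  "0 \<odot> w = 0" "w \<odot> 0 = 0"
  by (simp_all add: oct_mult_def oct_cross_def oct_scale_def prod_eq_iff vec_eq_iff
      algebra_simps sum.distrib sum_subtractf sum_negf sum_distrib_left)

lemma oct_dot_simps:
  "oct_dot (x + y) w = oct_dot x w + oct_dot y w" "oct_dot w (x + y) = oct_dot w x + oct_dot w y"
  "oct_dot (x - y) w = oct_dot x w - oct_dot y w" "oct_dot w (x - y) = oct_dot w x - oct_dot w y"
  "oct_dot (- x) w = - oct_dot x w" "oct_dot w (- x) = - oct_dot w x"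
  "oct_dot (a *\<^sub>C x) w = a * oct_dot x w" "oct_dot w (a *\<^sub>C x) = a * oct_dot w x"
  "oct_dot 0 w = 0" "oct_dot w 0 = 0"
  by (simp_all add: oct_dot_def oct_scale_def algebra_simps sum.distrib sum_subtractf sum_negf sum_distrib_left)

lemma oct_dot_commute: "oct_dot x y = oct_dot y x"
  by (simp add: oct_dot_def mult.commute)

lemma oct_of_simps:
  "oct_of a + oct_of b = oct_of (a + b)" "oct_of a - oct_of b = oct_of (a - b)"
  "a *\<^sub>C oct_of b = oct_of (a * b)" "oct_of 0 = 0" "oct_cnj (oct_of a) = oct_of a"
  "oct_of (- a) = - oct_of a"
  by (simp_all add: oct_of_def oct_scale_def oct_cnj_def prod_eq_iff)

lemma oct_mult_cnj_right:
  "(w \<odot> x) \<odot> oct_cnj y + (w \<odot> y) \<odot> oct_cnj x = (2 * oct_dot x y) *\<^sub>C w"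
proof -
  \<comment> \<open>Conjugation reverses products, so the right-handed identity is the conjugate of
    the left-handed one at conjugated arguments.\<close>
  have "oct_cnj (oct_cnj (oct_cnj x) \<odot> (oct_cnj y \<odot> oct_cnj w)
        + oct_cnj (oct_cnj y) \<odot> (oct_cnj x \<odot> oct_cnj w))
      = oct_cnj ((2 * oct_dot (oct_cnj x) (oct_cnj y)) *\<^sub>C oct_cnj w)"
    by (simp only: oct_mult_cnj_left)
  moreover have "oct_dot (oct_cnj x) (oct_cnj y) = oct_dot x y"
    by (simp add: oct_dot_def oct_cnj_def)
  ultimately show ?thesis by (simp add: oct_cnj_simps oct_cnj_mult add.commute)
qed

lemma oct_cnj_mult_self:
  "oct_cnj x \<odot> y + oct_cnj y \<odot> x = oct_of (2 * oct_dot x y)"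
  "x \<odot> oct_cnj y + y \<odot> oct_cnj x = oct_of (2 * oct_dot x y)"
  using oct_mult_cnj_left[of x y "oct_of 1"] oct_mult_cnj_right[of "oct_of 1" x y]
  by (simp_all add: oct_of_mult oct_scale_simps oct_of_simps)

section \<open>The Jordan product and \<open>D12\<close> in coordinates\<close>

lemmas herm_ext = herm_def vec_eq_iff forall_3 vector_3

lemma herm_eqI:
  assumes "a = a'" "b = b'" "c = c'" "x = x'" "y = y'" "w = w'"
  shows "herm a b c x y w = herm a' b' c' x' y' w'"
  using assms by simp

lemma herm_add:
  "herm a b c x y w + herm a' b' c' x' y' w' = herm (a + a') (b + b') (c + c') (x + x') (y + y') (w + w')"
  by (simp add: herm_ext oct_cnj_simps oct_of_simps)

lemma herm_diff:
  "herm a b c x y w - herm a' b' c' x' y' w' = herm (a - a') (b - b') (c - c') (x - x') (y - y') (w - w')"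
  by (simp add: herm_ext oct_cnj_simps oct_of_simps)

lemma herm_scale:
  "omat_scale k (herm a b c x y w) = herm (k * a) (k * b) (k * c) (k *\<^sub>C x) (k *\<^sub>C y) (k *\<^sub>C w)"
  by (simp add: herm_ext omat_scale_def oct_cnj_simps oct_of_simps)

lemma omat_scaleR: "r *\<^sub>R A = omat_scale (of_real r) A" for A :: omat
  by (simp add: vec_eq_iff omat_scale_def oct_scaleR)

lemma herm_uminus: "- herm a b c x y w = herm (- a) (- b) (- c) (- x) (- y) (- w)"
  by (simp add: herm_ext oct_cnj_simps oct_of_simps)

lemma jordan_herm:
  "jordan (herm a1 a2 a3 x1 x2 x3) (herm b1 b2 b3 y1 y2 y3) = herm
    (a1 * b1 + oct_dot x2 y2 + oct_dot x3 y3)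
    (a2 * b2 + oct_dot x1 y1 + oct_dot x3 y3)
    (a3 * b3 + oct_dot x1 y1 + oct_dot x2 y2)
    ((1/2) *\<^sub>C ((a2 + a3) *\<^sub>C y1 + (b2 + b3) *\<^sub>C x1
      + oct_cnj x3 \<odot> oct_cnj y2 + oct_cnj y3 \<odot> oct_cnj x2))
    ((1/2) *\<^sub>C ((a3 + a1) *\<^sub>C y2 + (b3 + b1) *\<^sub>C x2
      + oct_cnj x1 \<odot> oct_cnj y3 + oct_cnj y1 \<odot> oct_cnj x3))
    ((1/2) *\<^sub>C ((a1 + a2) *\<^sub>C y3 + (b1 + b2) *\<^sub>C x3
      + oct_cnj x2 \<odot> oct_cnj y1 + oct_cnj y2 \<odot> oct_cnj x1))"
proof -
  \<comment> \<open>Diagonal entries of the matrix products contain both orders, bar x y and x bar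
    y; after symmetrisation both are the same scalar.\<close>
  have 1: "oct_of (oct_dot x y) = (1/2) *\<^sub>C (oct_cnj x \<odot> y) + (1/2) *\<^sub>C (oct_cnj y \<odot> x)"
    and 2: "oct_of (oct_dot x y) = (1/2) *\<^sub>C (x \<odot> oct_cnj y) + (1/2) *\<^sub>C (y \<odot> oct_cnj x)" for x y
    using oct_cnj_mult_self[of x y]
    by (simp_all add: oct_of_simps flip: oct_scale_simps(1))
  have 3: "oct_of (a * b + c + d) = oct_of (a * b / 2) + oct_of (a * b / 2) + oct_of c + oct_of d" for a b c d
    by (simp add: oct_of_simps)
  show ?thesis
    by (simp add: herm_ext jordan_def omat_mult_def sum_3 oct_scaleR 3 oct_cnj_simps oct_cnj_mult
        oct_scale_simps oct_of_mult,
        simp add: 1 oct_of_simps(3) oct_scale_simps algebra_simps,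
        simp flip: 1 2)
qed

lemma pidem_diff: "pidem 1 - pidem 2 = herm 1 (- 1) 0 0 0 0"
  by (simp add: herm_ext pidem_def oct_of_simps oct_cnj_simps)

text \<open>The operator of \<open>pidem 1 - pidem 2\<close> has weights 1, -1, 0 on the diagonal
  and -1/2, 1/2, 0 on the three fibres. The commutator multiplies each component of the operator of
  \<open>F3 z\<close> by the difference of target and source weight.\<close>

lemma D12_herm:
  "D12 z (herm a1 a2 a3 x1 x2 x3) = herm (2 * oct_dot z x3) (- 2 * oct_dot z x3) 0
     (- (oct_cnj z \<odot> oct_cnj x2)) (oct_cnj x1 \<odot> oct_cnj z) ((a2 - a1) *\<^sub>C z)"
  unfolding D12_def op_comm_def Lmult_def pidem_diff F3_def jordan_herm herm_diff omat_scaleR herm_scale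
  by (rule herm_eqI; simp add: oct_dot_simps oct_scale_simps oct_cnj_simps oct_mult_simps;
      simp add: oct_scale_def prod_eq_iff vec_eq_iff field_simps)

lemma D12_derivation: "derivation_J3 (D12 z)"
  unfolding derivation_J3_def
proof (intro conjI ballI allI)
  fix A assume "A \<in> J3"
  then show "D12 z A \<in> J3" unfolding J3_def using D12_herm by blast
next
  fix A B assume "A \<in> J3" "B \<in> J3"
  then obtain a1 a2 a3 x1 x2 x3 b1 b2 b3 y1 y2 y3
    where AB: "A = herm a1 a2 a3 x1 x2 x3" "B = herm b1 b2 b3 y1 y2 y3" unfolding J3_def by blast
  show "D12 z (A + B) = D12 z A + D12 z B"
    unfolding AB D12_herm herm_add
    by (rule herm_eqI; simp add: oct_dot_simps oct_scale_simps oct_cnj_simps oct_mult_simps algebra_simps)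
  \<comment> \<open>For the Leibniz rule: \<open>k1\<close>, \<open>k2\<close>, \<open>k3\<close>
    serve the three octonion coordinates in this order. The first two bring the factor bar z to the
    outside, where applying \<open>D12 z\<close> to the product puts it; \<open>k3\<close> pairs the
    terms that add up to a multiple of z.\<close>
  have k1: "oct_cnj y3 \<odot> (z \<odot> x1) = (2 * oct_dot z y3) *\<^sub>C x1 - oct_cnj z \<odot> (y3 \<odot> x1)"
    "oct_cnj x3 \<odot> (z \<odot> y1) = (2 * oct_dot z x3) *\<^sub>C y1 - oct_cnj z \<odot> (x3 \<odot> y1)"
    using oct_mult_cnj_left[of z] by (simp_all add: eq_diff_eq add.commute)
  have k2: "(x2 \<odot> z) \<odot> oct_cnj y3 = (2 * oct_dot z y3) *\<^sub>C x2 - (x2 \<odot> y3) \<odot> oct_cnj z"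
    "(y2 \<odot> z) \<odot> oct_cnj x3 = (2 * oct_dot z x3) *\<^sub>C y2 - (y2 \<odot> x3) \<odot> oct_cnj z"
    using oct_mult_cnj_right[of _ z] by (simp_all add: eq_diff_eq add.commute)
  have k3: "(z \<odot> x1) \<odot> oct_cnj y1 = (2 * oct_dot x1 y1) *\<^sub>C z - (z \<odot> y1) \<odot> oct_cnj x1"
    "oct_cnj y2 \<odot> (x2 \<odot> z) = (2 * oct_dot x2 y2) *\<^sub>C z - oct_cnj x2 \<odot> (y2 \<odot> z)"
    using oct_mult_cnj_right[of z x1 y1] oct_mult_cnj_left[of x2 y2 z] by (simp_all add: eq_diff_eq add.commute)
  \<comment> \<open>For the diagonal coordinates: every trilinear term gets z as its first argument,
    so that equal terms become syntactically equal.\<close>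
  have d: "oct_dot (oct_cnj x1 \<odot> oct_cnj z) y2 = oct_dot z (oct_cnj y2 \<odot> oct_cnj x1)"
    "oct_dot x2 (oct_cnj y1 \<odot> oct_cnj z) = oct_dot z (oct_cnj x2 \<odot> oct_cnj y1)"
    "oct_dot (oct_cnj z \<odot> oct_cnj x2) y1 = oct_dot z (oct_cnj x2 \<odot> oct_cnj y1)"
    "oct_dot x1 (oct_cnj z \<odot> oct_cnj y2) = oct_dot z (oct_cnj y2 \<odot> oct_cnj x1)"
    "oct_dot x3 z = oct_dot z x3" "oct_dot y3 z = oct_dot z y3"
    using oct_dot_cyclic[of x1 z y2] oct_dot_cyclic[of y1 z x2]
      oct_dot_cyclic[of z x2 y1] oct_dot_cyclic[of z y2 x1]
    by (simp_all add: oct_dot_commute)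
  show "D12 z (jordan A B) = jordan (D12 z A) B + jordan A (D12 z B)"
    unfolding AB D12_herm herm_add jordan_herm
    by (rule herm_eqI; simp add: oct_dot_simps oct_scale_simps oct_cnj_simps oct_cnj_mult
        oct_mult_simps d k1 k2 k3;
      simp add: oct_scale_def prod_eq_iff vec_eq_iff field_simps)
next
  fix c A assume "A \<in> J3"
  then show "D12 z (omat_scale c A) = omat_scale c (D12 z A)"
    unfolding J3_def
    by (auto simp: D12_herm herm_scale oct_dot_simps oct_scale_simps oct_cnj_simps oct_mult_simps algebra_simps)
qed

section \<open>The exponential of an infinitesimal rotation\<close>

lemma op_exp_rotation:
  assumes T: "\<And>r s. T (r *\<^sub>R a + s *\<^sub>R b) = (r * \<theta>) *\<^sub>R b - (s * \<theta>) *\<^sub>R a"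
  shows "op_exp T a = cos \<theta> *\<^sub>R a + sin \<theta> *\<^sub>R b"
proof -
  \<comment> \<open>\<open>cos_coeff\<close> and \<open>sin_coeff\<close> vanish at odd and even n
    respectively, so one formula covers both parities; applying T exchanges them up to sign.\<close>
  have "(T ^^ n) a = (fact n * cos_coeff n * \<theta> ^ n) *\<^sub>R a + (fact n * sin_coeff n * \<theta> ^ n) *\<^sub>R b" for n
  proof (induction n)
    case (Suc n)
    then show ?case
      by (simp add: T cos_coeff_Suc sin_coeff_Suc field_simps del: of_nat_Suc)
  qed simp
  then have "(1 / fact n) *\<^sub>R (T ^^ n) a = (cos_coeff n *\<^sub>R \<theta> ^ n) *\<^sub>R a + (sin_coeff n *\<^sub>R \<theta> ^ n) *\<^sub>R b" for n
    by (simp add: scaleR_add_right)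
  moreover have "(\<lambda>n. (cos_coeff n *\<^sub>R \<theta> ^ n) *\<^sub>R a + (sin_coeff n *\<^sub>R \<theta> ^ n) *\<^sub>R b)
      sums (cos \<theta> *\<^sub>R a + sin \<theta> *\<^sub>R b)"
    by (intro sums_add sums_scaleR_left cos_converges sin_converges)
  ultimately show ?thesis
    by (simp add: op_exp_def sums_unique[symmetric])
qed

lemma D12_F1: "D12 z (F1 x) = F2 (oct_cnj x \<odot> oct_cnj z)"
  by (simp add: F1_def F2_def D12_herm oct_dot_simps oct_scale_simps oct_cnj_simps oct_mult_simps)

lemma D12_F2: "D12 z (F2 y) = - F1 (oct_cnj z \<odot> oct_cnj y)"
  by (simp add: F1_def F2_def D12_herm herm_uminus oct_dot_simps oct_scale_simps oct_cnj_simps oct_mult_simps)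

lemma op_exp_D12_F1:
  assumes "oct_dot z z = 1"
  shows "op_exp (\<lambda>X. \<theta> *\<^sub>R D12 z X) (F1 x) =
    cos \<theta> *\<^sub>R F1 x + sin \<theta> *\<^sub>R F2 (oct_cnj x \<odot> oct_cnj z)"
proof (rule op_exp_rotation)
  fix r s :: real
  \<comment> \<open>With both factors equal to z the polarised identity yields bar z (z x) = x twice
    over; hence \<open>D12 z\<close> sends F2 (bar x bar z) back to -F1 x.\<close>
  have "2 *\<^sub>C (oct_cnj z \<odot> (z \<odot> x)) = 2 *\<^sub>C x"
    using oct_mult_cnj_left[of z z x] assms oct_scale_simps(2)[of 1 1] by (simp add: oct_scale_simps)
  then have "oct_cnj z \<odot> (z \<odot> x) = x"
    by (simp add: oct_scale_def prod_eq_iff vec_eq_iff)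
  then show "\<theta> *\<^sub>R D12 z (r *\<^sub>R F1 x + s *\<^sub>R F2 (oct_cnj x \<odot> oct_cnj z))
      = (r * \<theta>) *\<^sub>R F2 (oct_cnj x \<odot> oct_cnj z) - (s * \<theta>) *\<^sub>R F1 x"
    by (simp add: F1_def F2_def omat_scaleR herm_scale herm_add D12_herm herm_diff oct_cnj_mult
       oct_dot_simps oct_scale_simps oct_cnj_simps oct_mult_simps mult.commute)
qed

section \<open>The transport data, amplitudes and phase\<close>

lemma oct_dot_e: "oct_dot (oct_e j) (oct_e k) = (if j = k then 1 else 0)"
  by (simp add: oct_dot_def oct_e_def sum_axis_axis)

lemma oct_dot_gdir: "oct_dot (- gdir chi) (- gdir chi) = 1"
proof -
  have "complex_of_real ((cos chi)\<^sup>2 + (sin chi)\<^sup>2) = 1" by simp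
  then show ?thesis
    unfolding of_real_add of_real_power
    by (simp add: gdir_def oct_scaleR oct_dot_simps oct_dot_e power2_eq_square add.commute)
qed

lemma exp_ii_eq:
  "exp (\<i> * of_real t) = of_real (cos t) + \<i> * of_real (sin t)"
  "exp (- \<i> * of_real t) = of_real (cos t) - \<i> * of_real (sin t)"
  by (simp_all add: exp_Euler exp_minus_Euler flip: cos_of_real sin_of_real)

text \<open>The signs of the two bars and of \<open>- gdir chi\<close> leave -u1 g. Since u1 e_3 =
  -u2 and u1 e_1 = -i u2, this is (cos chi - i sin chi) u2.\<close>

lemma u1_gdir: "oct_cnj u1 \<odot> oct_cnj (- gdir chi) = exp (- \<i> * of_real chi) *\<^sub>C u2"
  unfolding exp_ii_eq prod_eq_iff vec_eq_iff all_7
  by (simp add: u1_def u2_def gdir_def oct_scaleR oct_e_def oct_scale_def oct_cnj_def oct_mult_def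
      sum_7 oct_cross_nth axis_def algebra_simps)

text \<open>\<open>dbar1\<close> and \<open>dbar2\<close> are i times the complex conjugates of
  \<open>u1\<close> and \<open>u2\<close>, while g is real; so the phase is the conjugate
  one.\<close>

lemma dbar1_gdir: "oct_cnj dbar1 \<odot> oct_cnj (- gdir chi) = exp (\<i> * of_real chi) *\<^sub>C dbar2"
  unfolding exp_ii_eq prod_eq_iff vec_eq_iff all_7
  by (simp add: dbar1_def dbar2_def gdir_def oct_scaleR oct_e_def oct_scale_def oct_cnj_def oct_mult_def
      sum_7 oct_cross_nth axis_def algebra_simps)

lemma F2_inject: "F2 x = F2 y \<longleftrightarrow> x = y"
  by (auto simp: F2_def herm_ext)

text \<open>Nonzero y makes the scalar unique, which the definite description requires.\<close>

lemma transport_amplitude_eqI: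
  assumes "D12 z (F1 x) = F2 (A *\<^sub>C y)" "y \<noteq> 0"
  shows "transport_amplitude z x y = A"
proof -
  have "A = B" if "A *\<^sub>C y = B *\<^sub>C y" for B
    using that \<open>y \<noteq> 0\<close> by (auto simp: oct_scale_def prod_eq_iff vec_eq_iff)
  with assms show ?thesis
    by (auto simp: transport_amplitude_def F2_inject intro!: the_equality)
qed

lemma A_u_eq: "A_u chi = exp (- \<i> * of_real chi)"
proof -
  have "snd u2 $ 6 \<noteq> 0" by (simp add: u2_def oct_e_def oct_scale_def axis_def)
  then show ?thesis
    unfolding A_u_def by (intro transport_amplitude_eqI) (auto simp: D12_F1 u1_gdir)
qed

lemma A_d_eq: "A_d chi = exp (\<i> * of_real chi)"
proof -
  have "snd dbar2 $ 2 \<noteq> 0" by (simp add: dbar2_def oct_e_def oct_scale_def axis_def)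
  then show ?thesis
    unfolding A_d_def by (intro transport_amplitude_eqI) (auto simp: D12_F1 dbar1_gdir)
qed

text \<open>\<open>Arg\<close> is a principal value, so the difference may be off by a multiple of 2
  pi; passing to \<open>cis\<close> removes this ambiguity.\<close>

lemma phase12_rcong: "[phase12 chi = - (2 * chi)] (rmod (2 * pi))"
proof -
  have "A_u chi = cis (- chi)" "A_d chi = cis chi"
    by (simp_all add: A_u_eq A_d_eq cis_conv_exp)
  then have "cis (phase12 chi) = cis (- chi) / cis chi"
    by (simp add: phase12_def cis_Arg sgn_div_norm flip: cis_divide)
  also have "\<dots> = cis (- (2 * chi))" by (simp add: cis_divide)
  finally show ?thesis by (simp only: cis_eq_iff)
qed

theorem mainTheorem6:
  shows
    "(\<forall>z :: oct.
        D12 z \<in> f4C \<and>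
        (\<forall>x y :: oct.
           D12 z (F1 x) = F2 (oct_cnj x \<odot> oct_cnj z) \<and>
           D12 z (F2 y) = - F1 (oct_cnj z \<odot> oct_cnj y))) \<and>
     (\<forall>chi :: real.
        D12 (- gdir chi) (F1 u1) = F2 (exp (- \<i> * of_real chi) *\<^sub>C u2) \<and>
        D12 (- gdir chi) (F1 dbar1) = F2 (exp (\<i> * of_real chi) *\<^sub>C dbar2) \<and>
        (\<forall>\<theta> :: real.
           op_exp (\<lambda>X. \<theta> *\<^sub>R D12 (- gdir chi) X) (F1 u1) =
             cos \<theta> *\<^sub>R F1 u1 + sin \<theta> *\<^sub>R F2 (exp (- \<i> * of_real chi) *\<^sub>C u2) \<and>
           op_exp (\<lambda>X. \<theta> *\<^sub>R D12 (- gdir chi) X) (F1 dbar1) =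
             cos \<theta> *\<^sub>R F1 dbar1 + sin \<theta> *\<^sub>R F2 (exp (\<i> * of_real chi) *\<^sub>C dbar2)) \<and>
        A_u chi = exp (- \<i> * of_real chi) \<and>
        A_d chi = exp (\<i> * of_real chi) \<and>
        A_u chi = cnj (A_d chi) \<and>
        [phase12 chi = - 2 * chi] (rmod (2 * pi)))"
  using D12_derivation oct_dot_gdir
  by (auto simp: f4C_def D12_F1 D12_F2 u1_gdir dbar1_gdir op_exp_D12_F1 A_u_eq A_d_eq phase12_rcong exp_cnj)

end
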